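(* Let $\hat G=(I,P;E)$ be a pinned $\mathcal S$-isostatic graph in dimension $d$ which is pinned $d$-isostatic at every pinned $\mathcal S$-regular realisation, let $\hat H$ be its quotient $\mathcal S$-gain graph, and suppose the action of $\mathcal S$ is free on both the vertices and the edges of $\hat G$. Then the projection (under the covering map $\hat G\to\hat H$) of a $d$-Assur component of $\hat G$ is an $\mathcal S$-Assur component of $\hat H$, and the lift of an $\mathcal S$-Assur component of $\hat H$ is a set of one or more $d$-Assur components of $\hat G$ which are pairwise disjoint on inner vertices.
   Context: A pinned graph $\hat G=(I,P;E)$ is a finite simple graph on disjoint vertex set $I\cup P$ (inner and pinned vertices), no edge joining two pinned vertices. The pinned rigidity matrix $R(\hat G,\mathbf p)$ of $\mathbf p:I\cup P\to\mathbb R^d$ has one row per edge and $d$ columns per inner vertex; the row of $ij$ ($i,j\in I$) has $\mathbf p_i-\mathbf p_j$ in the columns of $i$ and $\mathbf p_j-\mathbf p_i$ in those of $j$; the row of $ik$ ($i\in I$, $k\in P$) has $\mathbf p_i-\mathbf p_k$ in the columns of $i$; zeros elsewhere. $(\hat G,\mathbf p)$ is pinned $d$-isostatic if this matrix is square and invertible. A $d$-directed orientation of $\hat G$ orients each edge so that each inner vertex has out-degree $d$ and each pinned vertex out-degree $0$; after identifying all pinned vertices into one ground sink, the strongly connected components of inner vertices (each with its outgoing edges, their heads becoming pins) are the $d$-Assur components of $\hat G$. Symmetric setting: $\mathcal S$ a finite group acting by $\theta$ on $\hat G$ preserving $I$ and $P$, $\tau:\mathcal S\to O(\mathbb R^d)$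 a homomorphism; $\mathbf p$ is $\mathcal S$-symmetric if $\tau(x)\mathbf p(v)=\mathbf p(xv)$. The quotient $\mathcal S$-gain graph $\hat H=(\hat I,\hat P;\hat E)$ has the vertex orbits as vertices and edge orbits as edges; with representatives fixed, the edge orbit $\{\{xu,xyv\}:x\in\mathcal S\}$ is an edge from $\tilde u$ to $\tilde v$ with gain $y$ (inverse gain for reversed direction). The covering map sends $xv\mapsto\tilde v$ and each edge to its orbit. The pinned orbit matrix has $d$ columns per inner orbit and a row per edge orbit: for $\tilde e=(\tilde u,\tilde v)$ inner, entries $\tilde{\mathbf p}(\tilde u)-\tau(\psi(\tilde e))\tilde{\mathbf p}(\tilde v)$ at $\tilde u$ and $\tilde{\mathbf p}(\tilde v)-\tau(\psi(\tilde e))^{-1}\tilde{\mathbf p}(\tilde u)$ at $\tilde v$; for a loop at $\tilde u$, $2\tilde{\mathbf p}(\tilde u)-\tau(\psi)\tilde{\mathbf p}(\tilde u)-\tau(\psi)^{-1}\tilde{\mathbf p}(\tilde u)$ at $\tilde u$; for $\tilde v$ pinned, only the $\tilde u$ entry $\tilde{\mathbf p}(\tilde u)-\tau(\psi(\tilde e))\tilde{\mathbf p}(\tilde v)$ ($\tilde{\mathbf p}$ = position of representative). Pinned $\mathcal S$-regular: maximal rank of this matrix over $\mathcal S$-symmetric pinned realisations; pinned $\mathcal S$-isostatic: this matrix is square and invertible at pinned $\mathcal S$-regular realisations. An $\mathcal S$-directed orientation of $\hat H$ gives every inner vertex out-degree $d$ (loops count once) and pinned vertices out-degree $0$; after identifying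 the pinned vertices to one ground sink, the strongly connected components of the inner vertices (with their outgoing edges) are the $\mathcal S$-Assur components of $\hat H$ (equivalently the minimal pinned $\mathcal S$-isostatic pieces of the $\mathcal S$-Assur decomposition). *)

theory Defs
  imports
    "HOL-Analysis.Analysis"
    "HOL-Algebra.Group_Action"
    "Graph_Theory.Digraph_Component"
    "Jordan_Normal_Form.DL_Rank"
begin

hide_const (open) Matrix.mat Matrix.vec Matrix.row Matrix.col Determinant.det
no_notation Matrix.vec_index (infixl \<open>$\<close> 100)

section \<open>Pinned graphs, orientations and Assur components\<close>

text \<open>
  Edges have an abstract type, so that one record serves both the simple graph (edges are
  two-element vertex sets) and its quotient multigraph (edges are edge orbits, with possible loops
  and multiple edges). A function sending an edge to its set of endpoints is passed along where
  it is needed; a loop has a singleton endpoint set.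
\<close>

record ('v, 'e) pinned_graph =
  inner_vs :: "'v set"
  pinned_vs :: "'v set"
  edges :: "'e set"

definition all_vs :: "('v, 'e, 'z) pinned_graph_scheme \<Rightarrow> 'v set" where
  "all_vs G = inner_vs G \<union> pinned_vs G"

definition simple_pinned_graph :: "('v, 'v set) pinned_graph \<Rightarrow> bool" where
  "simple_pinned_graph G \<longleftrightarrow>
     finite (inner_vs G) \<and> finite (pinned_vs G) \<and> inner_vs G \<inter> pinned_vs G = {} \<and>
     (\<forall>e \<in> edges G. e \<subseteq> all_vs G \<and> card e = 2 \<and> \<not> e \<subseteq> pinned_vs G)"

definition out_degree ::
  "('v, 'e, 'z) pinned_graph_scheme \<Rightarrow> ('e \<Rightarrow> 'v) \<Rightarrow> 'v \<Rightarrow> nat" where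
  "out_degree G t v = card {e \<in> edges G. t e = v}"

text \<open>An orientation is given by its tail map \<open>t\<close> and head map \<open>h\<close>.\<close>

definition directed_orientation ::
  "nat \<Rightarrow> ('v, 'e, 'z) pinned_graph_scheme \<Rightarrow> ('e \<Rightarrow> 'v set) \<Rightarrow> ('e \<Rightarrow> 'v) \<Rightarrow> ('e \<Rightarrow> 'v) \<Rightarrow> bool"
where
  "directed_orientation d G ends t h \<longleftrightarrow>
     (\<forall>e \<in> edges G. ends e = {t e, h e}) \<and>
     (\<forall>v \<in> inner_vs G. out_degree G t v = d) \<and>
     (\<forall>v \<in> pinned_vs G. out_degree G t v = 0)"

text \<open>The digraph obtained by identifying all pinned vertices to the ground vertex \<open>None\<close>.\<close>

definition to_ground :: "('v, 'e, 'z) pinned_graph_scheme \<Rightarrow> 'v \<Rightarrow> 'v option" where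
  "to_ground G v = (if v \<in> pinned_vs G then None else Some v)"

definition grounded_digraph ::
  "('v, 'e, 'z) pinned_graph_scheme \<Rightarrow> ('e \<Rightarrow> 'v) \<Rightarrow> ('e \<Rightarrow> 'v) \<Rightarrow> ('v option, 'e) pre_digraph"
where
  "grounded_digraph G t h =
     \<lparr> verts = to_ground G ` all_vs G, arcs = edges G,
       tail = to_ground G \<circ> t, head = to_ground G \<circ> h \<rparr>"

text \<open>A set of inner vertices with its outgoing edges, whose heads outside the set become pins.\<close>

definition out_piece ::
  "('v, 'e, 'z) pinned_graph_scheme \<Rightarrow> ('e \<Rightarrow> 'v) \<Rightarrow> ('e \<Rightarrow> 'v) \<Rightarrow> 'v set \<Rightarrow> ('v, 'e) pinned_graph"
where
  "out_piece G t h C =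
     \<lparr> inner_vs = C,
       pinned_vs = h ` {e \<in> edges G. t e \<in> C} - C,
       edges = {e \<in> edges G. t e \<in> C} \<rparr>"

text \<open>
  The components do not depend on the orientation: two orientations with the same out-degrees
  differ by reversals of directed cycles, each of which lies inside a strongly connected component.
  The pins of a component are recorded as vertices of the given graph, before the
  identification to the ground.
\<close>

definition assur_components ::
  "nat \<Rightarrow> ('v, 'e, 'z) pinned_graph_scheme \<Rightarrow> ('e \<Rightarrow> 'v set) \<Rightarrow> ('v, 'e) pinned_graph set"
where
  "assur_components d G ends =
     {out_piece G t h C | t h C.
        directed_orientation d G ends t h \<and> C \<subseteq> inner_vs G \<and>
        Some ` C \<in> pre_digraph.sccs_verts (grounded_digraph G t h)}"

definition d_assur_components :: "nat \<Rightarrow> ('v, 'v set) pinned_graph \<Rightarrow> ('v, 'v set) pinned_graph set"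
where
  "d_assur_components d G = assur_components d G (\<lambda>e. e)"


section \<open>Matrices with finite index sets, and the pinned rigidity matrix\<close>

text \<open>
  Rows and columns are listed by the library enumeration of the index sets; rank and
  invertibility do not depend on the enumeration.
\<close>

definition indexed_mat :: "'r set \<Rightarrow> 'c set \<Rightarrow> ('r \<Rightarrow> 'c \<Rightarrow> real) \<Rightarrow> real Matrix.mat" where
  "indexed_mat R C f =
     Matrix.mat (card R) (card C) (\<lambda>(i, j). f (from_nat_into R i) (from_nat_into C j))"

definition mat_rank :: "real Matrix.mat \<Rightarrow> nat" where
  "mat_rank A = vec_space.rank (dim_row A) A"

text \<open>The column of vertex \<open>i\<close> and coordinate \<open>k\<close> has index \<open>(i, k)\<close>.\<close>

definition pinned_rigidity_matrix ::
  "('v, 'v set) pinned_graph \<Rightarrow> ('v \<Rightarrow> real ^ 'n) \<Rightarrow> real Matrix.mat" where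
  "pinned_rigidity_matrix G p =
     indexed_mat (edges G) (inner_vs G \<times> UNIV)
       (\<lambda>e (i, k). if i \<in> e then (p i - p (the_elem (e - {i}))) $ k else 0)"

text \<open>Squareness is part of \<^const>\<open>invertible_mat\<close>.\<close>

definition pinned_isostatic :: "('v, 'v set) pinned_graph \<Rightarrow> ('v \<Rightarrow> real ^ 'n) \<Rightarrow> bool" where
  "pinned_isostatic G p \<longleftrightarrow> invertible_mat (pinned_rigidity_matrix G p)"


section \<open>Symmetry and the quotient gain graph\<close>

definition edge_action :: "('s \<Rightarrow> 'v \<Rightarrow> 'v) \<Rightarrow> 's \<Rightarrow> 'v set \<Rightarrow> 'v set" where
  "edge_action \<theta> x e = \<theta> x ` e"

definition acts_on_pinned_graph ::
  "('s, 'b) monoid_scheme \<Rightarrow> ('s \<Rightarrow> 'v \<Rightarrow> 'v) \<Rightarrow> ('v, 'v set) pinned_graph \<Rightarrow> bool" where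
  "acts_on_pinned_graph S \<theta> G \<longleftrightarrow>
     group_action S (all_vs G) \<theta> \<and>
     (\<forall>x \<in> carrier S. \<theta> x ` inner_vs G = inner_vs G \<and> \<theta> x ` pinned_vs G = pinned_vs G \<and>
        edge_action \<theta> x ` edges G = edges G)"

definition free_on_vertices ::
  "('s, 'b) monoid_scheme \<Rightarrow> ('s \<Rightarrow> 'v \<Rightarrow> 'v) \<Rightarrow> ('v, 'v set) pinned_graph \<Rightarrow> bool" where
  "free_on_vertices S \<theta> G \<longleftrightarrow> (\<forall>v \<in> all_vs G. stabilizer S \<theta> v = {\<one>\<^bsub>S\<^esub>})"

definition free_on_edges ::
  "('s, 'b) monoid_scheme \<Rightarrow> ('s \<Rightarrow> 'v \<Rightarrow> 'v) \<Rightarrow> ('v, 'v set) pinned_graph \<Rightarrow> bool" where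
  "free_on_edges S \<theta> G \<longleftrightarrow> (\<forall>e \<in> edges G. stabilizer S (edge_action \<theta>) e = {\<one>\<^bsub>S\<^esub>})"

definition orthogonal_rep ::
  "('s, 'b) monoid_scheme \<Rightarrow> ('s \<Rightarrow> real ^ 'n ^ 'n) \<Rightarrow> bool" where
  "orthogonal_rep S \<tau> \<longleftrightarrow>
     (\<forall>x \<in> carrier S. orthogonal_matrix (\<tau> x)) \<and>
     (\<forall>x \<in> carrier S. \<forall>y \<in> carrier S. \<tau> (x \<otimes>\<^bsub>S\<^esub> y) = \<tau> x ** \<tau> y)"

definition symmetric_realisation ::
  "('s, 'b) monoid_scheme \<Rightarrow> ('s \<Rightarrow> 'v \<Rightarrow> 'v) \<Rightarrow> ('s \<Rightarrow> real ^ 'n ^ 'n) \<Rightarrow>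
   ('v, 'v set) pinned_graph \<Rightarrow> ('v \<Rightarrow> real ^ 'n) \<Rightarrow> bool" where
  "symmetric_realisation S \<theta> \<tau> G p \<longleftrightarrow>
     (\<forall>x \<in> carrier S. \<forall>v \<in> all_vs G. \<tau> x *v p v = p (\<theta> x v))"

record ('v, 'e, 's) gain_graph = "('v, 'e) pinned_graph" +
  src :: "'e \<Rightarrow> 'v"
  tgt :: "'e \<Rightarrow> 'v"
  gain :: "'e \<Rightarrow> 's"

definition gain_ends :: "('v, 'e, 's) gain_graph \<Rightarrow> 'e \<Rightarrow> 'v set" where
  "gain_ends H e = {src H e, tgt H e}"

text \<open>
  \<open>H\<close> is a quotient gain graph of \<open>G\<close> for the orbit representatives \<open>rep\<close>. The maps
  \<^const>\<open>src\<close>, \<^const>\<open>tgt\<close> only fix a reference direction for reading off the gain (reversing it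
  inverts the gain); it is chosen with an inner source, so that an edge at a pinned vertex
  points to that vertex.
\<close>

definition quotient_gain_graph ::
  "('s, 'b) monoid_scheme \<Rightarrow> ('s \<Rightarrow> 'v \<Rightarrow> 'v) \<Rightarrow> ('v, 'v set) pinned_graph \<Rightarrow>
   ('v set \<Rightarrow> 'v) \<Rightarrow> ('v set, 'v set set, 's) gain_graph \<Rightarrow> bool" where
  "quotient_gain_graph S \<theta> G rep H \<longleftrightarrow>
     inner_vs H = orbits S (inner_vs G) \<theta> \<and>
     pinned_vs H = orbits S (pinned_vs G) \<theta> \<and>
     edges H = orbits S (edges G) (edge_action \<theta>) \<and>
     (\<forall>w \<in> all_vs H. rep w \<in> w) \<and>
     (\<forall>e \<in> edges H. src H e \<in> inner_vs H \<and> tgt H e \<in> all_vs H \<and> gain H e \<in> carrier S \<and>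
        e = {{\<theta> x (rep (src H e)), \<theta> (x \<otimes>\<^bsub>S\<^esub> gain H e) (rep (tgt H e))} | x. x \<in> carrier S})"

definition S_assur_components ::
  "nat \<Rightarrow> ('v, 'e, 's) gain_graph \<Rightarrow> ('v, 'e) pinned_graph set" where
  "S_assur_components d H = assur_components d H (gain_ends H)"


section \<open>The pinned orbit matrix\<close>

text \<open>
  Only inner vertices have columns, so an edge with pinned target contributes
  only the entry at its source.
\<close>

definition orbit_matrix_entry ::
  "('s \<Rightarrow> real ^ 'n ^ 'n) \<Rightarrow> ('v set, 'v set set, 's) gain_graph \<Rightarrow> ('v set \<Rightarrow> real ^ 'n) \<Rightarrow>
   'v set set \<Rightarrow> 'v set \<Rightarrow> real ^ 'n" where
  "orbit_matrix_entry \<tau> H q e w =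
     (let u = src H e; v = tgt H e; A = \<tau> (gain H e) in
      if u = v then
        (if w = u then 2 *\<^sub>R q u - A *v q u - matrix_inv A *v q u else 0)
      else if w = u then q u - A *v q v
      else if w = v then q v - matrix_inv A *v q u
      else 0)"

definition pinned_orbit_matrix ::
  "('s \<Rightarrow> real ^ 'n ^ 'n) \<Rightarrow> ('v set \<Rightarrow> 'v) \<Rightarrow> ('v set, 'v set set, 's) gain_graph \<Rightarrow>
   ('v \<Rightarrow> real ^ 'n) \<Rightarrow> real Matrix.mat" where
  "pinned_orbit_matrix \<tau> rep H p =
     indexed_mat (edges H) (inner_vs H \<times> UNIV)
       (\<lambda>e (w, k). orbit_matrix_entry \<tau> H (p \<circ> rep) e w $ k)"

definition pinned_S_regular ::
  "('s, 'b) monoid_scheme \<Rightarrow> ('s \<Rightarrow> 'v \<Rightarrow> 'v) \<Rightarrow> ('s \<Rightarrow> real ^ 'n ^ 'n) \<Rightarrow>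
   ('v, 'v set) pinned_graph \<Rightarrow> ('v set \<Rightarrow> 'v) \<Rightarrow> ('v set, 'v set set, 's) gain_graph \<Rightarrow>
   ('v \<Rightarrow> real ^ 'n) \<Rightarrow> bool" where
  "pinned_S_regular S \<theta> \<tau> G rep H p \<longleftrightarrow>
     symmetric_realisation S \<theta> \<tau> G p \<and>
     (\<forall>q. symmetric_realisation S \<theta> \<tau> G q \<longrightarrow>
        mat_rank (pinned_orbit_matrix \<tau> rep H q) \<le> mat_rank (pinned_orbit_matrix \<tau> rep H p))"

definition pinned_S_isostatic ::
  "('s, 'b) monoid_scheme \<Rightarrow> ('s \<Rightarrow> 'v \<Rightarrow> 'v) \<Rightarrow> ('s \<Rightarrow> real ^ 'n ^ 'n) \<Rightarrow>
   ('v, 'v set) pinned_graph \<Rightarrow> ('v set \<Rightarrow> 'v) \<Rightarrow> ('v set, 'v set set, 's) gain_graph \<Rightarrow> bool" where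
  "pinned_S_isostatic S \<theta> \<tau> G rep H \<longleftrightarrow>
     (\<forall>p. pinned_S_regular S \<theta> \<tau> G rep H p \<longrightarrow>
        invertible_mat (pinned_orbit_matrix \<tau> rep H p))"


section \<open>Projection and lift along the covering map\<close>

definition cover_v :: "('s, 'b) monoid_scheme \<Rightarrow> ('s \<Rightarrow> 'v \<Rightarrow> 'v) \<Rightarrow> 'v \<Rightarrow> 'v set" where
  "cover_v S \<theta> v = orbit S \<theta> v"

definition cover_e :: "('s, 'b) monoid_scheme \<Rightarrow> ('s \<Rightarrow> 'v \<Rightarrow> 'v) \<Rightarrow> 'v set \<Rightarrow> 'v set set" where
  "cover_e S \<theta> e = orbit S (edge_action \<theta>) e"

definition project ::
  "('s, 'b) monoid_scheme \<Rightarrow> ('s \<Rightarrow> 'v \<Rightarrow> 'v) \<Rightarrow>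
   ('v, 'v set) pinned_graph \<Rightarrow> ('v set, 'v set set) pinned_graph" where
  "project S \<theta> K =
     \<lparr> inner_vs = cover_v S \<theta> ` inner_vs K, pinned_vs = cover_v S \<theta> ` pinned_vs K,
       edges = cover_e S \<theta> ` edges K \<rparr>"

definition lift ::
  "('s, 'b) monoid_scheme \<Rightarrow> ('s \<Rightarrow> 'v \<Rightarrow> 'v) \<Rightarrow> ('v, 'v set) pinned_graph \<Rightarrow>
   ('v set, 'v set set) pinned_graph \<Rightarrow> ('v, 'v set) pinned_graph" where
  "lift S \<theta> G D =
     \<lparr> inner_vs = {v \<in> all_vs G. cover_v S \<theta> v \<in> inner_vs D},
       pinned_vs = {v \<in> all_vs G. cover_v S \<theta> v \<in> pinned_vs D},
       edges = {e \<in> edges G. cover_e S \<theta> e \<in> edges D} \<rparr>"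

definition union_graph :: "('v, 'e) pinned_graph set \<Rightarrow> ('v, 'e) pinned_graph" where
  "union_graph \<K> =
     \<lparr> inner_vs = \<Union> (inner_vs ` \<K>), pinned_vs = \<Union> (pinned_vs ` \<K>), edges = \<Union> (edges ` \<K>) \<rparr>"

end

theory Submission
  imports Defs "HOL-Algebra.Multiplicative_Group"
begin

text \<open>
  A set of inner vertices is closed under the outgoing edges of a \<open>d\<close>-directed orientation
  iff the number of edges it spans (together with the pins) is \<open>d\<close> times its size. This does not
  involve the orientation, so reachability, and with it the Assur components, are the same for all
  orientations. A nonzero term in the determinant of the orbit matrix is an orientation of the
  quotient; as the action is free, it lifts to an invariant orientation of the cover. A
  path from \<open>v\<close> to a translate \<open>x v\<close> in the cover can be continued to a closed walk, since \<open>x\<close> has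
  finite order; hence strong components of the cover map onto strong components of the quotient.
\<close>

section \<open>Orientations and strongly connected components\<close>

text \<open>Pins are not merged into a ground vertex here. In a directed orientation they have no
  outgoing arcs, so reachability between inner vertices is the same.\<close>

definition arc_rel :: "'e set \<Rightarrow> ('e \<Rightarrow> 'v) \<Rightarrow> ('e \<Rightarrow> 'v) \<Rightarrow> 'v rel" where
  "arc_rel E t h = (\<lambda>e. (t e, h e)) ` E"

text \<open>The strongly connected component of \<open>u\<close>, as a vertex set that can be
  compared between orientations and pushed along the covering map.\<close>

definition mutual :: "'v rel \<Rightarrow> 'v \<Rightarrow> 'v set" where
  "mutual r u = {v. (u, v) \<in> r\<^sup>* \<and> (v, u) \<in> r\<^sup>*}"

lemma arc_relI: "e \<in> E \<Longrightarrow> (t e, h e) \<in> arc_rel E t h"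
  by (auto simp: arc_rel_def)

lemma arc_relE:
  assumes "(u, v) \<in> arc_rel E t h"
  obtains e where "e \<in> E" "u = t e" "v = h e"
  using assms by (auto simp: arc_rel_def)

lemma mutual_refl: "u \<in> mutual r u"
  by (simp add: mutual_def)

lemma mutual_eq: "v \<in> mutual r u \<Longrightarrow> mutual r v = mutual r u"
  by (auto simp: mutual_def intro: rtrancl_trans)

text \<open>Common ground for the simple graph \<open>G\<close>, with the identity as
  \<open>ends\<close>, and the quotient multigraph \<open>H\<close>, with
  \<open>gain_ends H\<close>. Loops and parallel edges are allowed.\<close>

locale finite_pinned_graph =
  fixes G :: "('v, 'e, 'z) pinned_graph_scheme" and ends :: "'e \<Rightarrow> 'v set"
  assumes finite_inner: "finite (inner_vs G)"
    and finite_edges: "finite (edges G)"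
    and disjoint_vs: "inner_vs G \<inter> pinned_vs G = {}"
    and ends_subset: "e \<in> edges G \<Longrightarrow> ends e \<subseteq> all_vs G"

locale oriented_pinned_graph = finite_pinned_graph +
  fixes d :: nat and t h :: "'e \<Rightarrow> 'v"
  assumes orientation: "directed_orientation d G ends t h"
begin

abbreviation R where "R \<equiv> arc_rel (edges G) t h"

lemma ends_eq: "e \<in> edges G \<Longrightarrow> ends e = {t e, h e}"
  using orientation by (auto simp: directed_orientation_def)

lemma head_in: "e \<in> edges G \<Longrightarrow> h e \<in> all_vs G"
  using ends_subset ends_eq by blast

lemma tail_inner:
  assumes e: "e \<in> edges G" shows "t e \<in> inner_vs G"
proof (rule ccontr)
  assume "t e \<notin> inner_vs G"
  then have "t e \<in> pinned_vs G"
    using e ends_subset ends_eq by (fastforce simp: all_vs_def)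
  then have "card {f \<in> edges G. t f = t e} = 0"
    using orientation by (auto simp: directed_orientation_def out_degree_def)
  \<comment> \<open>Finiteness matters, because \<open>card\<close> of an infinite set is 0 as
    well.\<close>
  then show False using e finite_edges by auto
qed

lemma card_out_edges:
  assumes X: "X \<subseteq> inner_vs G"
  shows "card {e \<in> edges G. t e \<in> X} = d * card X"
proof -
  have fX: "finite X" using X finite_inner finite_subset by blast
  have "{e \<in> edges G. t e \<in> X} = (\<Union>v\<in>X. {e \<in> edges G. t e = v})" by auto
  also have "card \<dots> = (\<Sum>v\<in>X. card {e \<in> edges G. t e = v})"
    using fX finite_edges by (intro card_UN_disjoint) auto
  also have "\<dots> = (\<Sum>v\<in>X. d)"
    using X orientation by (intro sum.cong) (auto simp: directed_orientation_def out_degree_def)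
  finally show ?thesis by simp
qed

text \<open>The right-hand side does not mention the orientation.\<close>

lemma out_closed_iff:
  assumes X: "X \<subseteq> inner_vs G"
  shows "(\<forall>e\<in>edges G. t e \<in> X \<longrightarrow> h e \<in> X \<union> pinned_vs G) \<longleftrightarrow>
    card {e \<in> edges G. ends e \<inter> X \<noteq> {} \<and> ends e \<subseteq> X \<union> pinned_vs G} = d * card X"
    (is "?closed \<longleftrightarrow> card ?N = _")
proof -
  let ?O = "{e \<in> edges G. t e \<in> X}"
  \<comment> \<open>The tail is inner and lies in \<open>X \<union> pinned_vs G\<close>, hence in
    \<open>X\<close>.\<close>
  have sub: "?N \<subseteq> ?O"
    using ends_eq tail_inner disjoint_vs by fastforce
  \<comment> \<open>Closedness says that no edge leaving a vertex of \<open>X\<close> is missing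
    from \<open>?N\<close>. By finiteness this can be tested on cardinalities.\<close>
  have "?closed \<longleftrightarrow> ?N = ?O"
    using sub ends_eq by fastforce
  also have "\<dots> \<longleftrightarrow> card ?N = card ?O"
    using card_subset_eq[OF _ sub] finite_edges by auto
  finally show ?thesis using card_out_edges[OF X] by simp
qed

text \<open>Every vertex of a path except the last is a tail, and tails are inner.\<close>

lemma reach_from: "(u, v) \<in> R\<^sup>* \<Longrightarrow> v \<in> inner_vs G \<Longrightarrow> u \<in> inner_vs G"
  by (induction rule: converse_rtrancl_induct) (auto elim: arc_relE simp: tail_inner)

lemma mutual_subset: "u \<in> inner_vs G \<Longrightarrow> mutual R u \<subseteq> inner_vs G"
  using reach_from by (auto simp: mutual_def)

section \<open>Comparison with the strong components of the grounded digraph\<close>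

lemma arcs_ends_grounded:
  "arcs_ends (grounded_digraph G t h) = (\<lambda>e. (Some (t e), to_ground G (h e))) ` edges G"
  using tail_inner disjoint_vs
  by (force simp: arcs_ends_def grounded_digraph_def arc_to_ends_def to_ground_def)

text \<open>The ground has no outgoing arcs, so a path ending at \<open>Some v\<close> never visits
  \<open>None\<close> and comes from a path before grounding.\<close>

lemma grounded_reachD:
  assumes "reachable (grounded_digraph G t h) x (Some v)"
  shows "\<exists>u. x = Some u \<and> (u, v) \<in> R\<^sup>*"
  using assms unfolding reachable_def
proof (induction rule: converse_rtrancl_on_induct)
  case base
  then show ?case by simp
next
  case (step x y)
  then obtain e where e: "e \<in> edges G" "x = Some (t e)" "y = to_ground G (h e)"
    by (auto simp: arcs_ends_grounded)
  with step have "(h e, v) \<in> R\<^sup>*"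
    by (auto simp: to_ground_def split: if_splits)
  then show ?case
    using e arc_relI[of e "edges G" t h] by (auto intro: converse_rtrancl_into_rtrancl)
qed

lemma verts_grounded: "Some v \<in> verts (grounded_digraph G t h) \<longleftrightarrow> v \<in> inner_vs G"
  using disjoint_vs by (auto simp: grounded_digraph_def to_ground_def all_vs_def)

lemma grounded_reachI:
  assumes "(u, v) \<in> R\<^sup>*" "v \<in> inner_vs G"
  shows "reachable (grounded_digraph G t h) (Some u) (Some v)"
  using assms unfolding reachable_def
proof (induction rule: converse_rtrancl_induct)
  case base
  then show ?case by (auto simp: verts_grounded)
next
  case (step x y)
  \<comment> \<open>Library reachability stays inside the vertex set, so \<open>y\<close> is inner
    and grounding does not affect it.\<close>
  then have y: "Some y \<in> verts (grounded_digraph G t h)"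
    by (metis in_rtrancl_on_in_F(1))
  obtain e where e: "e \<in> edges G" "x = t e" "y = h e"
    using step.hyps(1) by (rule arc_relE)
  have "(Some x, Some y) \<in> arcs_ends (grounded_digraph G t h)"
    using e y disjoint_vs
    by (auto simp: arcs_ends_grounded verts_grounded to_ground_def intro!: image_eqI[of _ _ e])
  then show ?case
    using step e tail_inner verts_grounded by (meson converse_rtrancl_on_into_rtrancl_on)
qed

text \<open>Turns the library's strong components into classes of \<open>mutual\<close>. The
  restriction to images of inner vertices under \<open>Some\<close> discards the component of the
  ground.\<close>

lemma sccs_verts_grounded_iff:
  "C \<subseteq> inner_vs G \<and> Some ` C \<in> pre_digraph.sccs_verts (grounded_digraph G t h) \<longleftrightarrow>
   (\<exists>u\<in>inner_vs G. C = mutual R u)" (is "?L \<longleftrightarrow> ?M")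
proof
  assume L: ?L
  then obtain u where u: "u \<in> C" by (auto simp: pre_digraph.sccs_verts_def)
  have "C = mutual R u"
  proof (intro Set.set_eqI iffI)
    fix v assume v: "v \<in> C"
    then have "reachable (grounded_digraph G t h) (Some u) (Some v)"
      "reachable (grounded_digraph G t h) (Some v) (Some u)"
      using L u by (auto simp: pre_digraph.sccs_verts_def)
    then show "v \<in> mutual R u" by (auto simp: mutual_def dest!: grounded_reachD)
  next
    fix v assume v: "v \<in> mutual R u"
    moreover have "v \<in> inner_vs G" "u \<in> inner_vs G" using v u L mutual_subset by auto
    ultimately have "reachable (grounded_digraph G t h) (Some u) (Some v)"
      "reachable (grounded_digraph G t h) (Some v) (Some u)"
      by (auto simp: mutual_def intro: grounded_reachI)
    \<comment> \<open>This is the maximality clause in the definition of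
      \<open>sccs_verts\<close>.\<close>
    then have "Some v \<in> Some ` C"
      using L u unfolding pre_digraph.sccs_verts_def by blast
    then show "v \<in> C" by auto
  qed
  then show ?M using u L by auto
next
  assume ?M
  then obtain u where u: "u \<in> inner_vs G" "C = mutual R u" by auto
  have C: "C \<subseteq> inner_vs G" using u mutual_subset by auto
  have "u \<in> C" using u mutual_refl by auto
  moreover have "reachable (grounded_digraph G t h) (Some a) (Some b)" if "a \<in> C" "b \<in> C" for a b
    using that C u by (auto simp: mutual_def intro!: grounded_reachI intro: rtrancl_trans)
  moreover have "x \<in> Some ` C" if a: "a \<in> C" "reachable (grounded_digraph G t h) (Some a) x"
    "reachable (grounded_digraph G t h) x (Some a)" for a x
  proof -
    obtain v where v: "x = Some v" "(v, a) \<in> R\<^sup>*" using grounded_reachD[OF a(3)] by blast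
    moreover have "(a, v) \<in> R\<^sup>*" using grounded_reachD a(2) v(1) by blast
    ultimately show ?thesis using a(1) u mutual_eq[of a R u] by (auto simp: mutual_def)
  qed
  ultimately show ?L using C by (auto simp: pre_digraph.sccs_verts_def)
qed

lemma mutual_component:
  "u \<in> inner_vs G \<Longrightarrow> out_piece G t h (mutual R u) \<in> assur_components d G ends"
  using sccs_verts_grounded_iff[of "mutual R u"] orientation
  by (auto simp: assur_components_def)

end

text \<open>Each component comes with an orientation of its own, so the orientation is obtained here
  and not fixed by the locale.\<close>

lemma (in finite_pinned_graph) assur_componentE:
  assumes "K \<in> assur_components d G ends"
  obtains t h u where "directed_orientation d G ends t h" "u \<in> inner_vs G"
    "K = out_piece G t h (mutual (arc_rel (edges G) t h) u)"
proof -
  obtain t h C where th: "directed_orientation d G ends t h" "K = out_piece G t h C"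
    "C \<subseteq> inner_vs G \<and> Some ` C \<in> pre_digraph.sccs_verts (grounded_digraph G t h)"
    using assms by (auto simp: assur_components_def)
  interpret oriented_pinned_graph G ends d t h by unfold_locales (rule th(1))
  show ?thesis using that th sccs_verts_grounded_iff[of C] by auto
qed

section \<open>Independence of the orientation\<close>

locale two_orientations =
  O: oriented_pinned_graph G ends d t h + O': oriented_pinned_graph G ends d t' h'
  for G :: "('v, 'e, 'z) pinned_graph_scheme" and ends d t h t' h'
begin

text \<open>The inner vertices reachable from \<open>u\<close> in the second orientation form a
  closed set. By the edge count of \<open>out_closed_iff\<close> this set is closed in the first
  orientation too, so a path of the first cannot leave it except into a pin.\<close>

lemma reach_transfer:
  assumes uv: "(u, v) \<in> O.R\<^sup>*" and u: "u \<in> inner_vs G" and v: "v \<in> inner_vs G"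
  shows "(u, v) \<in> O'.R\<^sup>*"
proof -
  define X where "X = {v \<in> inner_vs G. (u, v) \<in> O'.R\<^sup>*}"
  have X: "X \<subseteq> inner_vs G" by (auto simp: X_def)
  have "\<forall>e\<in>edges G. t' e \<in> X \<longrightarrow> h' e \<in> X \<union> pinned_vs G"
    using O'.head_in
    by (auto simp: X_def all_vs_def intro: rtrancl_into_rtrancl[OF _ arc_relI])
  then have closed: "\<forall>e\<in>edges G. t e \<in> X \<longrightarrow> h e \<in> X \<union> pinned_vs G"
    using O.out_closed_iff[OF X] O'.out_closed_iff[OF X] by simp
  \<comment> \<open>The last vertex of a path may be a pin, so the invariant admits pins. Any
    further arc has an inner tail, which must then lie in \<open>X\<close>.\<close>
  have "v \<in> X \<union> pinned_vs G"
    using uv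
  proof (induction rule: rtrancl_induct)
    case base
    then show ?case using u by (auto simp: X_def)
  next
    case (step y z)
    obtain e where "e \<in> edges G" "y = t e" "z = h e" using step(2) by (rule arc_relE)
    then show ?case using step.IH closed O.tail_inner O.disjoint_vs by blast
  qed
  then show ?thesis using v O.disjoint_vs by (auto simp: X_def)
qed

lemma mutual_transfer:
  assumes u: "u \<in> inner_vs G" shows "mutual O.R u = mutual O'.R u"
proof -
  interpret sym: two_orientations G ends d t' h' t h ..
  show ?thesis
    using reach_transfer sym.reach_transfer O.mutual_subset[OF u] O'.mutual_subset[OF u] u
    unfolding mutual_def by blast
qed

text \<open>If the two orientations disagree on \<open>e\<close>, the reversed arc gives a path back
  from \<open>h e\<close> to \<open>t e\<close>, and this path transfers. So \<open>e\<close> lies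
  on a directed cycle and both its ends are in one component.\<close>

lemma tail_transfer:
  assumes u: "u \<in> inner_vs G" and e: "e \<in> edges G" and te: "t e \<in> mutual O.R u"
  shows "t' e \<in> mutual O.R u"
proof (rule ccontr)
  assume no: "t' e \<notin> mutual O.R u"
  have "{t e, h e} = {t' e, h' e}" using O.ends_eq O'.ends_eq e by metis
  then have eq: "t' e = h e" "h' e = t e" using te no by (auto simp: doubleton_eq_iff)
  have "(h e, t e) \<in> O'.R\<^sup>*" using arc_relI[OF e, of t' h'] eq by auto
  moreover interpret sym: two_orientations G ends d t' h' t h ..
  have "h e \<in> inner_vs G" using O'.tail_inner[OF e] eq by simp
  ultimately have "(h e, t e) \<in> O.R\<^sup>*"
    using sym.reach_transfer O.tail_inner[OF e] by blast
  moreover have "(t e, h e) \<in> O.R" using e by (rule arc_relI)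
  ultimately have "h e \<in> mutual O.R (t e)" by (auto simp: mutual_def)
  then show False using mutual_eq[OF te] no eq by simp
qed

lemma out_piece_transfer:
  assumes u: "u \<in> inner_vs G"
  shows "out_piece G t h (mutual O.R u) = out_piece G t' h' (mutual O'.R u)"
proof -
  interpret sym: two_orientations G ends d t' h' t h ..
  define C where "C = mutual O.R u"
  have C': "mutual O'.R u = C" using mutual_transfer[OF u] by (simp add: C_def)
  have tails: "{e \<in> edges G. t e \<in> C} = {e \<in> edges G. t' e \<in> C}"
    using tail_transfer[OF u] sym.tail_transfer[OF u] unfolding C' C_def[symmetric] by blast
  \<comment> \<open>Tails lie in \<open>C\<close>, so replacing heads by full endpoint sets changes
    nothing outside \<open>C\<close> and removes the orientation from the description of the
    pins.\<close>
  have "h ` {e \<in> edges G. t e \<in> C} - C = \<Union> (ends ` {e \<in> edges G. t e \<in> C}) - C"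
    using O.ends_eq by auto
  also have "\<dots> = h' ` {e \<in> edges G. t' e \<in> C} - C"
    using O'.ends_eq tails by auto
  finally show ?thesis
    using tails unfolding C' C_def[symmetric] by (simp add: out_piece_def)
qed

end

section \<open>The covering map of a free action\<close>

locale pinned_cover = group S
  for S :: "('s, 'b) monoid_scheme" and \<theta> :: "'s \<Rightarrow> 'v \<Rightarrow> 'v"
    and G :: "('v, 'v set) pinned_graph" and rep :: "'v set \<Rightarrow> 'v"
    and H :: "('v set, 'v set set, 's) gain_graph" +
  assumes finite_group: "finite (carrier S)"
    and simple: "simple_pinned_graph G"
    and acts: "acts_on_pinned_graph S \<theta> G"
    and quotient: "quotient_gain_graph S \<theta> G rep H"
    and free_v: "free_on_vertices S \<theta> G"
    and free_e: "free_on_edges S \<theta> G"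
begin

abbreviation cov where "cov \<equiv> cover_v S \<theta>"
abbreviation cove where "cove \<equiv> cover_e S \<theta>"

sublocale act: group_action S "all_vs G" \<theta>
  using acts by (auto simp: acts_on_pinned_graph_def)

lemma act_all: "x \<in> carrier S \<Longrightarrow> v \<in> all_vs G \<Longrightarrow> \<theta> x v \<in> all_vs G"
  using act.element_image by blast

lemma act_mult: "x \<in> carrier S \<Longrightarrow> y \<in> carrier S \<Longrightarrow> v \<in> all_vs G \<Longrightarrow>
    \<theta> (x \<otimes>\<^bsub>S\<^esub> y) v = \<theta> x (\<theta> y v)"
  using act.composition_rule by blast

lemma act_one: "v \<in> all_vs G \<Longrightarrow> \<theta> \<one>\<^bsub>S\<^esub> v = v"
  using act.id_eq_one by (metis restrict_apply')

lemma act_inner: "x \<in> carrier S \<Longrightarrow> v \<in> inner_vs G \<Longrightarrow> \<theta> x v \<in> inner_vs G"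
  and act_edge: "x \<in> carrier S \<Longrightarrow> e \<in> edges G \<Longrightarrow> \<theta> x ` e \<in> edges G"
  using acts by (fastforce simp: acts_on_pinned_graph_def edge_action_def)+

lemma edge_subset: "e \<in> edges G \<Longrightarrow> e \<subseteq> all_vs G"
  using simple by (auto simp: simple_pinned_graph_def)

lemma vs_disjoint: "inner_vs G \<inter> pinned_vs G = {}"
  using simple by (auto simp: simple_pinned_graph_def)

lemma act_image_mult: "x \<in> carrier S \<Longrightarrow> y \<in> carrier S \<Longrightarrow> A \<subseteq> all_vs G \<Longrightarrow>
    \<theta> (x \<otimes>\<^bsub>S\<^esub> y) ` A = \<theta> x ` \<theta> y ` A"
  using act_mult by (force simp: image_image)

lemma act_image_one: "A \<subseteq> all_vs G \<Longrightarrow> \<theta> \<one>\<^bsub>S\<^esub> ` A = A"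
  using act_one by (force simp: image_def)

lemma free_vD: "x \<in> carrier S \<Longrightarrow> v \<in> all_vs G \<Longrightarrow> \<theta> x v = v \<Longrightarrow> x = \<one>\<^bsub>S\<^esub>"
  using free_v by (fastforce simp: free_on_vertices_def stabilizer_def)

lemma free_eD: "x \<in> carrier S \<Longrightarrow> e \<in> edges G \<Longrightarrow> \<theta> x ` e = e \<Longrightarrow> x = \<one>\<^bsub>S\<^esub>"
  using free_e by (fastforce simp: free_on_edges_def stabilizer_def edge_action_def)

lemma cov_self: "v \<in> all_vs G \<Longrightarrow> v \<in> cov v"
  using act.orbit_refl by (simp add: cover_v_def)

lemma cov_act:
  assumes "x \<in> carrier S" "v \<in> all_vs G" shows "cov (\<theta> x v) = cov v"
proof -
  have "\<theta> y (\<theta> x v) \<in> cov v" if "y \<in> carrier S" for y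
    using that assms act_mult[of y x v, symmetric] by (auto simp: cover_v_def orbit_def)
  moreover have "\<theta> y v \<in> cov (\<theta> x v)" if "y \<in> carrier S" for y
  proof -
    have "\<theta> y v = \<theta> (y \<otimes>\<^bsub>S\<^esub> inv\<^bsub>S\<^esub> x) (\<theta> x v)"
      using that assms act_mult[of "y \<otimes>\<^bsub>S\<^esub> inv\<^bsub>S\<^esub> x" x v, symmetric] by (simp add: m_assoc)
    then show ?thesis using that assms by (auto simp: cover_v_def orbit_def)
  qed
  ultimately show ?thesis by (auto simp: cover_v_def orbit_def)
qed

lemma cov_eqD:
  assumes "cov u = cov v" "v \<in> all_vs G"
  obtains x where "x \<in> carrier S" "v = \<theta> x u"
  using cov_self[OF assms(2)] assms(1) that by (auto simp: cover_v_def orbit_def)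

lemma cove_act:
  assumes "x \<in> carrier S" "e \<in> edges G" shows "cove (\<theta> x ` e) = cove e"
proof -
  have sub: "e \<subseteq> all_vs G" using assms edge_subset by auto
  have "\<theta> y ` \<theta> x ` e \<in> cove e" if "y \<in> carrier S" for y
    using that assms act_image_mult[of y x e, symmetric] sub
    by (auto simp: cover_e_def orbit_def edge_action_def)
  moreover have "\<theta> y ` e \<in> cove (\<theta> x ` e)" if "y \<in> carrier S" for y
  proof -
    have "\<theta> y ` e = \<theta> (y \<otimes>\<^bsub>S\<^esub> inv\<^bsub>S\<^esub> x) ` \<theta> x ` e"
      using that assms act_image_mult[of "y \<otimes>\<^bsub>S\<^esub> inv\<^bsub>S\<^esub> x" x e, symmetric] sub by (simp add: m_assoc)
    then show ?thesis using that assms unfolding cover_e_def orbit_def edge_action_def by fastforce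
  qed
  ultimately show ?thesis by (auto simp: cover_e_def orbit_def edge_action_def)
qed

lemma cove_self: "e \<in> edges G \<Longrightarrow> e \<in> cove e"
  using act_image_one[OF edge_subset] unfolding cover_e_def orbit_def edge_action_def by force

lemma cove_eqD:
  assumes "cove e = cove f" "f \<in> edges G"
  obtains x where "x \<in> carrier S" "f = \<theta> x ` e"
proof -
  have "f \<in> cove e" using cove_self[OF assms(2)] assms(1) by simp
  then show ?thesis using that by (auto simp: cover_e_def orbit_def edge_action_def)
qed

section \<open>Vertices and edges of the quotient\<close>

lemma inner_H: "inner_vs H = cov ` inner_vs G"
  and pinned_H: "pinned_vs H = cov ` pinned_vs G"
  and edges_H: "edges H = cove ` edges G"
  using quotient by (auto simp: quotient_gain_graph_def orbits_def cover_v_def cover_e_def)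

lemma all_H: "all_vs H = cov ` all_vs G"
  by (auto simp: all_vs_def inner_H pinned_H)

text \<open>The action preserves inner vertices, so an orbit cannot mix inner vertices and
  pins.\<close>

lemma cov_inner_iff:
  assumes "v \<in> all_vs G" shows "cov v \<in> inner_vs H \<longleftrightarrow> v \<in> inner_vs G"
proof
  assume "cov v \<in> inner_vs H"
  then obtain u where "u \<in> inner_vs G" "cov u = cov v" by (auto simp: inner_H)
  then show "v \<in> inner_vs G" using act_inner assms by (metis cov_eqD)
qed (auto simp: inner_H)

lemma disjoint_H: "inner_vs H \<inter> pinned_vs H = {}"
  using cov_inner_iff vs_disjoint by (fastforce simp: pinned_H all_vs_def)

lemma finite_edges_G: "finite (edges G)"
proof (rule finite_subset)
  show "edges G \<subseteq> Pow (all_vs G)" using edge_subset by auto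
  show "finite (Pow (all_vs G))" using simple by (auto simp: simple_pinned_graph_def all_vs_def)
qed

sublocale GG: finite_pinned_graph G "\<lambda>e. e"
  using simple edge_subset finite_edges_G
  by unfold_locales (auto simp: simple_pinned_graph_def)

sublocale HH: finite_pinned_graph H "gain_ends H"
proof
  show "gain_ends H e \<subseteq> all_vs H" if "e \<in> edges H" for e
    using quotient that by (auto simp: quotient_gain_graph_def gain_ends_def all_vs_def)
qed (use GG.finite_inner finite_edges_G disjoint_H in \<open>auto simp: inner_H edges_H\<close>)

lemma rep_in:
  assumes "w \<in> all_vs H" shows "rep w \<in> all_vs G" "cov (rep w) = w"
proof -
  obtain v where v: "v \<in> all_vs G" "w = cov v" using assms by (auto simp: all_H)
  have "rep w \<in> cov v" using quotient assms v by (auto simp: quotient_gain_graph_def)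
  then obtain x where "x \<in> carrier S" "rep w = \<theta> x v" by (auto simp: cover_v_def orbit_def)
  then show "rep w \<in> all_vs G" "cov (rep w) = w" using v act_all cov_act by auto
qed

text \<open>Absorbing the gain into the target point \<open>?b\<close> makes the description of the
  edge orbit symmetric in its two ends. It can then be read in either direction without inverting
  gains.\<close>

lemma base_edge:
  assumes f: "f \<in> edges H" and tw: "gain_ends H f = {w, w'}"
  shows "\<exists>a b. a \<in> all_vs G \<and> b \<in> all_vs G \<and> cov a = w \<and> cov b = w' \<and>
    f = {{\<theta> x a, \<theta> x b} | x. x \<in> carrier S}"
proof -
  let ?a = "rep (src H f)" and ?b = "\<theta> (gain H f) (rep (tgt H f))"
  have q: "src H f \<in> all_vs H" "tgt H f \<in> all_vs H" "gain H f \<in> carrier S"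
    "f = {{\<theta> x ?a, \<theta> (x \<otimes>\<^bsub>S\<^esub> gain H f) (rep (tgt H f))} | x. x \<in> carrier S}"
    using quotient f by (auto simp: quotient_gain_graph_def all_vs_def)
  have ab: "?a \<in> all_vs G" "?b \<in> all_vs G" "cov ?a = src H f" "cov ?b = tgt H f"
    using q rep_in act_all cov_act by auto
  have eq: "{\<theta> x ?a, \<theta> (x \<otimes>\<^bsub>S\<^esub> gain H f) (rep (tgt H f))} = {\<theta> x ?a, \<theta> x ?b}"
    if "x \<in> carrier S" for x
    using act_mult[OF that] q(2,3) rep_in by auto
  have fe: "f = {{\<theta> x ?a, \<theta> x ?b} | x. x \<in> carrier S}"
    using q(4) eq by (smt (verit) Collect_cong)
  then have fe': "f = {{\<theta> x ?b, \<theta> x ?a} | x. x \<in> carrier S}"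
    by (simp add: insert_commute)
  show ?thesis
    using tw ab fe fe' unfolding gain_ends_def doubleton_eq_iff by blast
qed

text \<open>The element \<open>?z\<close> fixes the edge as a set, though it might swap its ends.
  Freeness on edges excludes this as well.\<close>

lemma edge_translate_unique:
  assumes "x \<in> carrier S" "y \<in> carrier S" "a \<in> all_vs G" "b \<in> all_vs G"
    and e: "{\<theta> x a, \<theta> x b} \<in> edges G" and eq: "{\<theta> x a, \<theta> x b} = {\<theta> y a, \<theta> y b}"
  shows "x = y"
proof -
  let ?z = "y \<otimes>\<^bsub>S\<^esub> inv\<^bsub>S\<^esub> x"
  have "\<theta> ?z (\<theta> x c) = \<theta> y c" if "c \<in> all_vs G" for c
    using that assms act_mult[of ?z x c, symmetric] by (simp add: m_assoc)
  then have "\<theta> ?z ` {\<theta> x a, \<theta> x b} = {\<theta> x a, \<theta> x b}"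
    using assms(3,4) by (subst (2) eq) simp
  then have "?z = \<one>\<^bsub>S\<^esub>" using free_eD[OF _ e] assms by auto
  then show ?thesis using assms by (metis inv_equality inv_inv inv_closed)
qed

section \<open>Lifting an orientation of the quotient to the cover\<close>

definition equivariant_lift where
  "equivariant_lift d t0 h0 t h \<longleftrightarrow> directed_orientation d G (\<lambda>e. e) t h \<and>
     (\<forall>e\<in>edges G. cov (t e) = t0 (cove e) \<and> cov (h e) = h0 (cove e)) \<and>
     (\<forall>x\<in>carrier S. \<forall>e\<in>edges G. t (\<theta> x ` e) = \<theta> x (t e) \<and> h (\<theta> x ` e) = \<theta> x (h e))"

text \<open>Freeness on edges makes the lift single-valued, also over loops; freeness on vertices makes
  the covering map a bijection between the edges leaving \<open>v\<close> and those leaving its orbit.\<close>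

lemma equivariant_lift_exists:
  assumes or: "directed_orientation d H (gain_ends H) t0 h0"
  shows "\<exists>t h. equivariant_lift d t0 h0 t h"
proof -
  \<comment> \<open>Each edge orbit receives a base pair \<open>a\<close>, \<open>b\<close> over its
    prescribed tail and head. Over a loop, where both lie in the same vertex orbit, this choice
    decides the direction.\<close>
  have "\<forall>f\<in>edges H. \<exists>a b. a \<in> all_vs G \<and> b \<in> all_vs G \<and> cov a = t0 f \<and> cov b = h0 f \<and>
      f = {{\<theta> x a, \<theta> x b} | x. x \<in> carrier S}"
    using or by (intro ballI base_edge) (simp_all add: directed_orientation_def)
  then obtain a b where "\<forall>f\<in>edges H. a f \<in> all_vs G \<and> b f \<in> all_vs G \<and>
      cov (a f) = t0 f \<and> cov (b f) = h0 f \<and> f = {{\<theta> x (a f), \<theta> x (b f)} | x. x \<in> carrier S}"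
    unfolding bchoice_iff by blast
  then have ab: "a f \<in> all_vs G" "b f \<in> all_vs G" "cov (a f) = t0 f" "cov (b f) = h0 f"
    and fib: "f = {{\<theta> x (a f), \<theta> x (b f)} | x. x \<in> carrier S}" if "f \<in> edges H" for f
    using that by blast+
  have "\<forall>e\<in>edges G. \<exists>x\<in>carrier S. e = {\<theta> x (a (cove e)), \<theta> x (b (cove e))}"
  proof
    fix e assume e: "e \<in> edges G"
    have "cove e \<in> edges H" using e by (simp add: edges_H)
    then have "e \<in> {{\<theta> x (a (cove e)), \<theta> x (b (cove e))} | x. x \<in> carrier S}"
      using fib[of "cove e"] cove_self[OF e] by simp
    then show "\<exists>x\<in>carrier S. e = {\<theta> x (a (cove e)), \<theta> x (b (cove e))}" by blast
  qed
  then have ex: "\<exists>x. x \<in> carrier S \<and> e = {\<theta> x (a (cove e)), \<theta> x (b (cove e))}"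
    if "e \<in> edges G" for e
    using that unfolding Bex_def by (rule bspec)
  \<comment> \<open>The group element that carries the base pair to \<open>e\<close>. It is unique
    by \<open>edge_translate_unique\<close>, so the choice operator selects nothing
    arbitrary.\<close>
  define X where
    "X e = (SOME x. x \<in> carrier S \<and> e = {\<theta> x (a (cove e)), \<theta> x (b (cove e))})" for e
  have X: "X e \<in> carrier S" "e = {\<theta> (X e) (a (cove e)), \<theta> (X e) (b (cove e))}"
    if "e \<in> edges G" for e
    using someI_ex[OF ex[OF that], folded X_def] by (rule conjunct1, rule conjunct2)
  define t where "t e = \<theta> (X e) (a (cove e))" for e
  define h where "h e = \<theta> (X e) (b (cove e))" for e
  have ab': "a (cove e) \<in> all_vs G" "b (cove e) \<in> all_vs G" if "e \<in> edges G" for e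
    using ab[of "cove e"] that by (auto simp: edges_H)
  \<comment> \<open>Both elements carry the base pair to the translated edge, so uniqueness
    identifies them. Equivariance of \<open>t\<close> and \<open>h\<close> follows.\<close>
  have XT: "X (\<theta> x ` e) = x \<otimes>\<^bsub>S\<^esub> X e" if x: "x \<in> carrier S" and e: "e \<in> edges G" for x e
  proof -
    have xe: "\<theta> x ` e \<in> edges G" using act_edge that by auto
    have "\<theta> x ` e = {\<theta> x (\<theta> (X e) (a (cove e))), \<theta> x (\<theta> (X e) (b (cove e)))}"
      using X(2)[OF e] by (metis image_insert image_empty)
    also have "\<dots> = {\<theta> (x \<otimes>\<^bsub>S\<^esub> X e) (a (cove e)), \<theta> (x \<otimes>\<^bsub>S\<^esub> X e) (b (cove e))}"
      using act_mult x X(1)[OF e] ab'[OF e] by auto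
    finally have 1: "\<theta> x ` e = \<dots>" .
    have 2: "\<theta> x ` e = {\<theta> (X (\<theta> x ` e)) (a (cove e)), \<theta> (X (\<theta> x ` e)) (b (cove e))}"
      using X(2)[OF xe] cove_act[OF x e] by simp
    show ?thesis
      by (rule edge_translate_unique[of _ _ "a (cove e)" "b (cove e)"])
         (use 1 2 xe x X(1)[OF e] X(1)[OF xe] ab'[OF e] in \<open>auto\<close>)
  qed
  have equi: "t (\<theta> x ` e) = \<theta> x (t e)" "h (\<theta> x ` e) = \<theta> x (h e)"
    if "x \<in> carrier S" "e \<in> edges G" for x e
    using that XT[OF that] act_mult X(1) ab' cove_act by (auto simp: t_def h_def)
  have cv: "cov (t e) = t0 (cove e)" "cov (h e) = h0 (cove e)" if "e \<in> edges G" for e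
    using that cov_act X(1) ab' ab[of "cove e"] by (auto simp: t_def h_def edges_H)
  have deg: "out_degree G t v = out_degree H t0 (cov v)" if v: "v \<in> all_vs G" for v
    unfolding out_degree_def
  proof (rule bij_betw_same_card[of cove], unfold bij_betw_def, intro conjI)
    show "inj_on cove {e \<in> edges G. t e = v}"
    proof (rule inj_onI, clarify)
      fix e f assume *: "e \<in> edges G" "f \<in> edges G" "cove e = cove f" "v = t e" "t f = t e"
      obtain x where x: "x \<in> carrier S" "f = \<theta> x ` e" using cove_eqD * by metis
      then have "\<theta> x v = v" using equi(1)[of x e] * by simp
      then have "x = \<one>\<^bsub>S\<^esub>" using free_vD x v by blast
      then show "e = f" using x * act_image_one edge_subset by auto
    qed
    show "cove ` {e \<in> edges G. t e = v} = {f \<in> edges H. t0 f = cov v}"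
    proof (intro equalityI subsetI)
      fix f assume "f \<in> {f \<in> edges H. t0 f = cov v}"
      then obtain e where e: "e \<in> edges G" "f = cove e" "t0 f = cov v" by (auto simp: edges_H)
      then have "cov (t e) = cov v" using cv by auto
      \<comment> \<open>Translating \<open>e\<close> by \<open>x\<close> moves its tail to
        \<open>v\<close> without leaving the orbit \<open>f\<close>.\<close>
      then obtain x where x: "x \<in> carrier S" "v = \<theta> x (t e)" using cov_eqD v by metis
      then have "t (\<theta> x ` e) = v" "\<theta> x ` e \<in> edges G" "cove (\<theta> x ` e) = f"
        using equi e act_edge cove_act by auto
      then show "f \<in> cove ` {e \<in> edges G. t e = v}" by blast
    qed (auto simp: edges_H cv[symmetric])
  qed
  have "directed_orientation d G (\<lambda>e. e) t h"
    unfolding directed_orientation_def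
  proof (intro conjI ballI)
    fix v assume "v \<in> inner_vs G"
    then show "out_degree G t v = d"
      using or deg[of v] by (auto simp: directed_orientation_def inner_H all_vs_def)
  next
    fix v assume "v \<in> pinned_vs G"
    then show "out_degree G t v = 0"
      using or deg[of v] by (auto simp: directed_orientation_def pinned_H all_vs_def)
  qed (use X(2) in \<open>simp add: t_def h_def\<close>)
  then show ?thesis using equi cv unfolding equivariant_lift_def by blast
qed

end

section \<open>Paths in the cover and in the quotient\<close>

locale lifted_orientation = pinned_cover +
  fixes d t0 h0 t h
  assumes base_orientation: "directed_orientation d H (gain_ends H) t0 h0"
    and lift: "equivariant_lift d t0 h0 t h"
begin

sublocale OG: oriented_pinned_graph G "\<lambda>e. e" d t h
  using lift by unfold_locales (auto simp: equivariant_lift_def)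

sublocale OH: oriented_pinned_graph H "gain_ends H" d t0 h0
  using base_orientation by unfold_locales

lemma cov_tail: "e \<in> edges G \<Longrightarrow> cov (t e) = t0 (cove e)"
  and cov_head: "e \<in> edges G \<Longrightarrow> cov (h e) = h0 (cove e)"
  and tail_act: "x \<in> carrier S \<Longrightarrow> e \<in> edges G \<Longrightarrow> t (\<theta> x ` e) = \<theta> x (t e)"
  and head_act: "x \<in> carrier S \<Longrightarrow> e \<in> edges G \<Longrightarrow> h (\<theta> x ` e) = \<theta> x (h e)"
  using lift by (auto simp: equivariant_lift_def)

text \<open>Some edge lies over \<open>f\<close>, and a translate of it has its tail at
  \<open>v\<close>, because the tail map is equivariant.\<close>

lemma lift_edge_tail:
  assumes "f \<in> edges H" "v \<in> all_vs G" "cov v = t0 f"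
  obtains e where "e \<in> edges G" "cove e = f" "t e = v"
proof -
  obtain e where e: "e \<in> edges G" "f = cove e" using assms by (auto simp: edges_H)
  then obtain x where "x \<in> carrier S" "v = \<theta> x (t e)" using assms cov_tail cov_eqD by metis
  then show ?thesis using that[of "\<theta> x ` e"] e act_edge cove_act tail_act by auto
qed

text \<open>The same translation argument at the head. It is what recovers the pins of a lifted
  component.\<close>

lemma lift_edge_head:
  assumes "f \<in> edges H" "v \<in> all_vs G" "cov v = h0 f"
  obtains e where "e \<in> edges G" "cove e = f" "h e = v"
proof -
  obtain e where e: "e \<in> edges G" "f = cove e" using assms by (auto simp: edges_H)
  then obtain x where "x \<in> carrier S" "v = \<theta> x (h e)" using assms cov_head cov_eqD by metis
  then show ?thesis using that[of "\<theta> x ` e"] e act_edge cove_act head_act by auto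
qed

lemma reach_project: "(u, v) \<in> OG.R\<^sup>* \<Longrightarrow> (cov u, cov v) \<in> OH.R\<^sup>*"
proof (induction rule: rtrancl_induct)
  case (step y z)
  obtain e where e: "e \<in> edges G" "y = t e" "z = h e" using step(2) by (rule arc_relE)
  then have "(cov y, cov z) \<in> OH.R"
    using arc_relI[of "cove e" "edges H" t0 h0] cov_tail cov_head by (auto simp: edges_H)
  then show ?case using step.IH by (rule rtrancl_into_rtrancl[rotated])
qed simp

text \<open>Path lifting, arc by arc from the start. Only the orbit of the end point can be
  prescribed.\<close>

lemma reach_lift:
  assumes "(cov v, w) \<in> OH.R\<^sup>*" "v \<in> all_vs G"
  shows "\<exists>v'\<in>all_vs G. (v, v') \<in> OG.R\<^sup>* \<and> cov v' = w"
  using assms(1)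
proof (induction rule: rtrancl_induct)
  case base
  then show ?case using assms by auto
next
  case (step y z)
  then obtain v' where v': "v' \<in> all_vs G" "(v, v') \<in> OG.R\<^sup>*" "cov v' = y" by auto
  obtain f where f: "f \<in> edges H" "y = t0 f" "z = h0 f" using step(2) by (rule arc_relE)
  obtain e where e: "e \<in> edges G" "cove e = f" "t e = v'" using lift_edge_tail f v' by metis
  then have "(v, h e) \<in> OG.R\<^sup>*" using v' arc_relI[OF e(1), of t h] by (auto intro: rtrancl_into_rtrancl)
  then show ?case using e f cov_head OG.head_in by auto
qed

lemma reach_act:
  assumes "x \<in> carrier S" "(u, v) \<in> OG.R\<^sup>*"
  shows "(\<theta> x u, \<theta> x v) \<in> OG.R\<^sup>*"
  using assms(2)
proof (induction rule: rtrancl_induct)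
  case (step y z)
  obtain e where e: "e \<in> edges G" "y = t e" "z = h e" using step(2) by (rule arc_relE)
  then have "(\<theta> x y, \<theta> x z) \<in> OG.R"
    using arc_relI[of "\<theta> x ` e" "edges G" t h] act_edge tail_act head_act assms by auto
  then show ?case using step.IH by (rule rtrancl_into_rtrancl[rotated])
qed simp

text \<open>A path from \<open>v\<close> to a translate \<open>x v\<close> is continued by its translates until it returns
  to \<open>v\<close>, because \<open>x\<close> has finite order.\<close>

lemma reach_translate_back:
  assumes x: "x \<in> carrier S" and v: "v \<in> all_vs G" and r: "(v, \<theta> x v) \<in> OG.R\<^sup>*"
  shows "(\<theta> x v, v) \<in> OG.R\<^sup>*"
proof -
  \<comment> \<open>The walk starts at the first power, hence \<open>Suc n\<close>. It closes up
    when \<open>Suc n\<close> is the order of the group.\<close>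
  have "(\<theta> x v, \<theta> (x [^]\<^bsub>S\<^esub> Suc n) v) \<in> OG.R\<^sup>*" for n
  proof (induction n)
    case 0
    then show ?case using x by simp
  next
    case (Suc n)
    have "(\<theta> (x [^]\<^bsub>S\<^esub> Suc n) v, \<theta> (x [^]\<^bsub>S\<^esub> Suc n) (\<theta> x v)) \<in> OG.R\<^sup>*"
      using reach_act r x by (simp del: nat_pow_Suc)
    also have "\<theta> (x [^]\<^bsub>S\<^esub> Suc n) (\<theta> x v) = \<theta> (x [^]\<^bsub>S\<^esub> Suc (Suc n)) v"
      using act_mult x v by simp
    finally show ?case using Suc.IH by (rule rtrancl_trans[rotated])
  qed
  moreover obtain n where "order S = Suc n"
    using finite_group order_gt_0_iff_finite by (metis gr0_implies_Suc)
  ultimately show ?thesis using pow_order_eq_1[OF x] act_one[OF v] by metis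
qed

text \<open>The return path in the quotient lifts to a path from \<open>v\<close> to a translate of
  \<open>u\<close>. Hence \<open>u\<close> reaches this translate, which reaches \<open>u\<close>
  again by \<open>reach_translate_back\<close>.\<close>

lemma reach_back:
  assumes r: "(u, v) \<in> OG.R\<^sup>*" and ret: "(cov v, cov u) \<in> OH.R\<^sup>*"
    and u: "u \<in> all_vs G" and v: "v \<in> all_vs G"
  shows "(v, u) \<in> OG.R\<^sup>*"
proof -
  obtain u' where u': "u' \<in> all_vs G" "(v, u') \<in> OG.R\<^sup>*" "cov u' = cov u"
    using reach_lift[OF ret v] by auto
  then obtain x where x: "x \<in> carrier S" "u' = \<theta> x u" using cov_eqD by metis
  then have "(\<theta> x u, u) \<in> OG.R\<^sup>*" using reach_translate_back r u' u by (meson rtrancl_trans)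
  then show ?thesis using u' x by (auto intro: rtrancl_trans)
qed

section \<open>Strong components of the cover and of the quotient\<close>

lemma mutualI:
  assumes "(u, v) \<in> OG.R\<^sup>*" "cov v \<in> mutual OH.R (cov u)" "u \<in> all_vs G" "v \<in> all_vs G"
  shows "v \<in> mutual OG.R u"
  using assms reach_back by (auto simp: mutual_def)

lemma cov_mutual:
  assumes u: "u \<in> all_vs G"
  shows "cov ` mutual OG.R u = mutual OH.R (cov u)"
proof (intro equalityI subsetI)
  fix w assume w: "w \<in> mutual OH.R (cov u)"
  then obtain v where "v \<in> all_vs G" "(u, v) \<in> OG.R\<^sup>*" "cov v = w"
    using reach_lift u by (auto simp: mutual_def)
  then show "w \<in> cov ` mutual OG.R u" using mutualI w u by blast
qed (auto simp: mutual_def intro: reach_project)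

text \<open>An arc leaving a component upstairs also leaves its image downstairs, so pins project to
  pins and never to inner vertices of the same component.\<close>

lemma head_in_mutual:
  assumes u: "u \<in> inner_vs G" and e: "e \<in> edges G" "t e \<in> mutual OG.R u"
    and he: "cov (h e) \<in> mutual OH.R (cov u)"
  shows "h e \<in> mutual OG.R u"
proof (rule mutualI)
  show "(u, h e) \<in> OG.R\<^sup>*"
    using e arc_relI[OF e(1), of t h] by (auto simp: mutual_def intro: rtrancl_into_rtrancl)
qed (use assms OG.head_in in \<open>auto simp: all_vs_def\<close>)

lemma project_out_piece:
  assumes u: "u \<in> inner_vs G"
  shows "project S \<theta> (out_piece G t h (mutual OG.R u)) = out_piece H t0 h0 (mutual OH.R (cov u))"
proof -
  let ?C = "mutual OG.R u" and ?D = "mutual OH.R (cov u)"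
  have u': "u \<in> all_vs G" using u by (simp add: all_vs_def)
  have C: "?C \<subseteq> all_vs G" using OG.mutual_subset[OF u] by (auto simp: all_vs_def)
  have img: "cov ` ?C = ?D" using cov_mutual[OF u'] .
  \<comment> \<open>Every tail in \<open>?D\<close> has a point of \<open>?C\<close> over it, at
    which the edge can be lifted.\<close>
  have up: "\<exists>e\<in>edges G. cove e = f \<and> t e \<in> ?C" if f: "f \<in> edges H" "t0 f \<in> ?D" for f
  proof -
    have "t0 f \<in> cov ` ?C" using f img by simp
    then obtain c where c: "c \<in> ?C" "cov c = t0 f" by auto
    obtain e where "e \<in> edges G" "cove e = f" "t e = c"
      using lift_edge_tail[OF f(1) subsetD[OF C c(1)] c(2)] by blast
    then show ?thesis using c by auto
  qed
  have edges: "cove ` {e \<in> edges G. t e \<in> ?C} = {f \<in> edges H. t0 f \<in> ?D}"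
  proof (intro equalityI subsetI)
    fix f assume "f \<in> {f \<in> edges H. t0 f \<in> ?D}"
    then show "f \<in> cove ` {e \<in> edges G. t e \<in> ?C}" using up by blast
  qed (use img cov_tail in \<open>auto simp: edges_H\<close>)
  have "cov ` (h ` {e \<in> edges G. t e \<in> ?C} - ?C) = h0 ` {f \<in> edges H. t0 f \<in> ?D} - ?D"
  proof (intro equalityI subsetI)
    fix w assume "w \<in> cov ` (h ` {e \<in> edges G. t e \<in> ?C} - ?C)"
    then obtain e where e: "w = cov (h e)" "e \<in> edges G" "t e \<in> ?C" "h e \<notin> ?C" by auto
    have "cove e \<in> edges H" "t0 (cove e) \<in> ?D" "w = h0 (cove e)"
      using e img cov_tail[OF e(2)] cov_head[OF e(2)] by (auto simp: edges_H)
    moreover have "w \<notin> ?D" using head_in_mutual[OF u] e by blast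
    ultimately show "w \<in> h0 ` {f \<in> edges H. t0 f \<in> ?D} - ?D" by auto
  next
    fix w assume "w \<in> h0 ` {f \<in> edges H. t0 f \<in> ?D} - ?D"
    then obtain f where f: "f \<in> edges H" "t0 f \<in> ?D" "w = h0 f" "w \<notin> ?D" by auto
    then obtain e where e: "e \<in> edges G" "cove e = f" "t e \<in> ?C" using up by blast
    then have "w = cov (h e)" using cov_head f by auto
    moreover have "h e \<notin> ?C" using img f calculation by auto
    ultimately show "w \<in> cov ` (h ` {e \<in> edges G. t e \<in> ?C} - ?C)" using e by auto
  qed
  then show ?thesis using edges img by (simp add: project_def out_piece_def)
qed

text \<open>The inner vertices over the component split into classes of mutual reachability. By
  \<open>head_in_mutual\<close> no arc runs from one class to another, so pins of the pieces stay
  outside the fibre of the component. Different \<open>u\<close> may name the same piece.\<close>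

lemma lift_out_piece:
  assumes w: "w \<in> inner_vs H"
  defines "\<K> \<equiv> {out_piece G t h (mutual OG.R u) | u. u \<in> inner_vs G \<and> cov u \<in> mutual OH.R w}"
  shows "\<K> \<noteq> {}" "pairwise (\<lambda>A B. inner_vs A \<inter> inner_vs B = {}) \<K>"
    "lift S \<theta> G (out_piece H t0 h0 (mutual OH.R w)) = union_graph \<K>"
proof -
  let ?D = "mutual OH.R w"
  show "\<K> \<noteq> {}" using w mutual_refl[of w OH.R] by (fastforce simp: inner_H \<K>_def)
  show "pairwise (\<lambda>A B. inner_vs A \<inter> inner_vs B = {}) \<K>"
  proof (rule pairwiseI)
    fix A B assume "A \<in> \<K>" "B \<in> \<K>" and AB: "A \<noteq> B"
    then obtain u v where A: "A = out_piece G t h (mutual OG.R u)"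
      and B: "B = out_piece G t h (mutual OG.R v)"
      unfolding \<K>_def by blast
    have "mutual OG.R u \<noteq> mutual OG.R v" using AB unfolding A B by metis
    then have "mutual OG.R u \<inter> mutual OG.R v = {}"
      using mutual_eq[of _ OG.R u] mutual_eq[of _ OG.R v] by (metis disjoint_iff)
    then show "inner_vs A \<inter> inner_vs B = {}" by (simp add: A B out_piece_def)
  qed
  \<comment> \<open>The class of \<open>u\<close> projects onto the class of \<open>cov u\<close>,
    which is \<open>?D\<close>.\<close>
  have mem: "v \<in> inner_vs G \<and> cov v \<in> ?D"
    if "u \<in> inner_vs G" "cov u \<in> ?D" "v \<in> mutual OG.R u" for u v
    using that cov_mutual[of u] mutual_eq[of "cov u" OH.R w] OG.mutual_subset[of u]
    by (auto simp: all_vs_def)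
  have inner_iff: "v \<in> inner_vs G" if "v \<in> all_vs G" "cov v \<in> ?D" for v
    using that OH.mutual_subset[OF w] cov_inner_iff by auto
  have I: "{v \<in> all_vs G. cov v \<in> ?D} = \<Union> (inner_vs ` \<K>)"
  proof (intro equalityI subsetI)
    fix v assume "v \<in> {v \<in> all_vs G. cov v \<in> ?D}"
    then have "v \<in> inner_vs G" "cov v \<in> ?D" using inner_iff by auto
    then have "out_piece G t h (mutual OG.R v) \<in> \<K>" unfolding \<K>_def by blast
    then show "v \<in> \<Union> (inner_vs ` \<K>)"
      using mutual_refl[of v OG.R] by (force simp: out_piece_def)
  next
    fix v assume "v \<in> \<Union> (inner_vs ` \<K>)"
    then obtain u where "u \<in> inner_vs G" "cov u \<in> ?D" "v \<in> mutual OG.R u"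
      unfolding \<K>_def out_piece_def by auto
    then show "v \<in> {v \<in> all_vs G. cov v \<in> ?D}" using mem[of u v] by (simp add: all_vs_def)
  qed
  have E: "{e \<in> edges G. cove e \<in> {f \<in> edges H. t0 f \<in> ?D}} = \<Union> (edges ` \<K>)"
  proof (intro equalityI subsetI)
    fix e assume "e \<in> {e \<in> edges G. cove e \<in> {f \<in> edges H. t0 f \<in> ?D}}"
    then have "e \<in> edges G" "cov (t e) \<in> ?D" "t e \<in> inner_vs G"
      using cov_tail OG.tail_inner by auto
    then have "out_piece G t h (mutual OG.R (t e)) \<in> \<K>"
      and "e \<in> edges (out_piece G t h (mutual OG.R (t e)))"
      unfolding \<K>_def by (blast, simp add: out_piece_def mutual_refl)
    then show "e \<in> \<Union> (edges ` \<K>)" by blast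
  next
    fix e assume "e \<in> \<Union> (edges ` \<K>)"
    then obtain u where u: "u \<in> inner_vs G" "cov u \<in> ?D"
      and "e \<in> edges (out_piece G t h (mutual OG.R u))"
      unfolding \<K>_def by blast
    then have e: "e \<in> edges G" "t e \<in> mutual OG.R u" by (simp_all add: out_piece_def)
    show "e \<in> {e \<in> edges G. cove e \<in> {f \<in> edges H. t0 f \<in> ?D}}"
      using e mem[OF u e(2)] cov_tail[OF e(1)] by (simp add: edges_H)
  qed
  have P: "{v \<in> all_vs G. cov v \<in> h0 ` {f \<in> edges H. t0 f \<in> ?D} - ?D} = \<Union> (pinned_vs ` \<K>)"
  proof (intro equalityI subsetI)
    fix v assume "v \<in> {v \<in> all_vs G. cov v \<in> h0 ` {f \<in> edges H. t0 f \<in> ?D} - ?D}"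
    then obtain f where f: "v \<in> all_vs G" "f \<in> edges H" "t0 f \<in> ?D" "cov v = h0 f" "cov v \<notin> ?D"
      by auto
    then obtain e where e: "e \<in> edges G" "cove e = f" "h e = v" using lift_edge_head by metis
    let ?u = "t e"
    have u: "?u \<in> inner_vs G" "cov ?u \<in> ?D" using e f cov_tail OG.tail_inner by auto
    then have "v \<notin> mutual OG.R ?u" using mem f by blast
    then have "v \<in> pinned_vs (out_piece G t h (mutual OG.R ?u))"
      using e mutual_refl[of ?u OG.R] by (auto simp: out_piece_def)
    then show "v \<in> \<Union> (pinned_vs ` \<K>)" using u unfolding \<K>_def by blast
  next
    fix v assume "v \<in> \<Union> (pinned_vs ` \<K>)"
    then obtain u where u: "u \<in> inner_vs G" "cov u \<in> ?D"
      and "v \<in> pinned_vs (out_piece G t h (mutual OG.R u))"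
      unfolding \<K>_def by blast
    then obtain e where e: "e \<in> edges G" "t e \<in> mutual OG.R u" "v = h e" "v \<notin> mutual OG.R u"
      by (auto simp: out_piece_def)
    \<comment> \<open>Otherwise the head would already belong to the component of
      \<open>u\<close>.\<close>
    have "cov v \<notin> ?D"
      using head_in_mutual[OF u(1) e(1,2)] e(3,4) mutual_eq[OF u(2)] by auto
    moreover have "t0 (cove e) \<in> ?D" using mem[OF u e(2)] cov_tail[OF e(1)] by auto
    ultimately show "v \<in> {v \<in> all_vs G. cov v \<in> h0 ` {f \<in> edges H. t0 f \<in> ?D} - ?D}"
      using e OG.head_in[OF e(1)] cov_head[OF e(1)] by (auto simp: edges_H)
  qed
  show "lift S \<theta> G (out_piece H t0 h0 ?D) = union_graph \<K>"
    using I E P by (simp add: lift_def out_piece_def union_graph_def)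
qed

end

section \<open>An orientation from the orbit matrix\<close>

lemma invertible_imp_det_nonzero:
  fixes A :: "'a :: comm_ring_1 Matrix.mat"
  assumes "invertible_mat A" shows "Determinant.det A \<noteq> 0"
proof -
  obtain B where sq: "dim_col A = dim_row A" and AB: "A * B = 1\<^sub>m (dim_row A)"
    and BA: "B * A = 1\<^sub>m (dim_row B)"
    using assms by (auto simp: invertible_mat_def inverts_mat_def)
  have A: "A \<in> carrier_mat (dim_row A) (dim_row A)" using sq by (intro carrier_matI refl)
  \<comment> \<open>The size of the inverse is read off from the dimensions of the two identity
    matrices.\<close>
  have B: "B \<in> carrier_mat (dim_row A) (dim_row A)"
    using arg_cong[OF AB, of dim_col] arg_cong[OF BA, of dim_col] sq by (intro carrier_matI) simp_all
  have "Determinant.det A * Determinant.det B = 1"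
    unfolding det_mult[OF A B, symmetric] AB by simp
  then show ?thesis by auto
qed

text \<open>A nonzero term of the Leibniz expansion of the determinant.\<close>

lemma invertible_indexed_mat_matching:
  assumes inv: "invertible_mat (indexed_mat R C f)" and fin: "finite R" "finite C"
  shows "\<exists>\<phi>. bij_betw \<phi> R C \<and> (\<forall>r\<in>R. f r (\<phi> r) \<noteq> 0)"
proof -
  let ?A = "indexed_mat R C f" and ?n = "card R"
  have n: "card C = ?n" using inv by (auto simp: invertible_mat_def indexed_mat_def)
  have A: "?A \<in> carrier_mat ?n ?n" using n by (simp add: indexed_mat_def)
  have "(\<Sum>p | p permutes {0..<?n}. signof p * (\<Prod>i = 0..<?n. ?A $$ (i, p i))) \<noteq> 0"
    using invertible_imp_det_nonzero[OF inv] det_def'[OF A] by simp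
  then obtain p where p: "p permutes {0..<?n}" and nz: "(\<Prod>i = 0..<?n. ?A $$ (i, p i)) \<noteq> 0"
    using sum.neutral by (metis (mono_tags, lifting) mem_Collect_eq mult_zero_right)
  let ?r = "from_nat_into R" and ?c = "from_nat_into C"
  have r: "bij_betw ?r {..<?n} R" and c: "bij_betw ?c {..<?n} C"
    using bij_betw_from_nat_into_finite fin n by metis+
  have pb: "bij_betw p {..<?n} {..<?n}"
    using permutes_imp_bij[OF p] by (simp add: atLeast0LessThan)
  \<comment> \<open>The permutation, transported from positions to row and column indices.\<close>
  define \<phi> where "\<phi> = ?c \<circ> p \<circ> the_inv_into {..<?n} ?r"
  have "bij_betw \<phi> R C"
    unfolding \<phi>_def using bij_betw_the_inv_into[OF r] pb c
    by (auto intro!: bij_betw_trans)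
  moreover have "f x (\<phi> x) \<noteq> 0" if x: "x \<in> R" for x
  proof -
    obtain i where i: "i < ?n" "x = ?r i"
      using bij_betw_imp_surj_on[OF r] x by (metis imageE lessThan_iff)
    have "p i < ?n" using pb i by (auto simp: bij_betw_def)
    then have "?A $$ (i, p i) = f (?r i) (?c (p i))"
      using i n by (simp add: indexed_mat_def)
    moreover have "?A $$ (i, p i) \<noteq> 0" using nz i by simp
    moreover have "\<phi> x = ?c (p i)"
      using i r by (simp add: \<phi>_def the_inv_into_f_f bij_betw_def)
    ultimately show ?thesis using i by simp
  qed
  ultimately show ?thesis by blast
qed

section \<open>Regular realisations and the orientation of the quotient\<close>

lemma mat_rank_le_dim_col: "mat_rank A \<le> dim_col A"
  unfolding mat_rank_def by (rule vec_space.rank_le_nc[of A]) auto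

text \<open>The zero map is symmetric and ranks are bounded by the number of columns, so the maximum
  is attained. Without a regular realisation, \<open>pinned_S_isostatic\<close> would hold
  vacuously.\<close>

lemma pinned_S_regular_exists:
  fixes \<tau> :: "'s \<Rightarrow> real ^ 'n ^ 'n" and G :: "('v, 'v set) pinned_graph"
  shows "\<exists>p. pinned_S_regular S \<theta> \<tau> G rep H p"
proof -
  let ?rk = "\<lambda>p. mat_rank (pinned_orbit_matrix \<tau> rep H p)"
  have "symmetric_realisation S \<theta> \<tau> G (\<lambda>v. 0)"
    by (simp add: symmetric_realisation_def)
  moreover have "?rk p \<le> card (inner_vs H \<times> (UNIV :: 'n set))" for p :: "'v \<Rightarrow> real ^ 'n"
    using mat_rank_le_dim_col[of "pinned_orbit_matrix \<tau> rep H p"]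
    by (simp add: pinned_orbit_matrix_def indexed_mat_def)
  ultimately obtain p where "symmetric_realisation S \<theta> \<tau> G p"
    "\<forall>q. symmetric_realisation S \<theta> \<tau> G q \<longrightarrow> ?rk q \<le> ?rk p"
    using ex_has_greatest_nat[of "symmetric_realisation S \<theta> \<tau> G" _ ?rk] less_Suc_eq_le by metis
  then show ?thesis by (auto simp: pinned_S_regular_def)
qed

text \<open>Match edges with columns along nonzero entries, and let the vertex of the matched column
  be the tail. An inner vertex owns one column per coordinate, which gives its out-degree.\<close>

lemma (in pinned_cover) isostatic_orientation:
  fixes \<tau> :: "'s \<Rightarrow> real ^ 'n ^ 'n"
  assumes iso: "pinned_S_isostatic S \<theta> \<tau> G rep H"
  shows "\<exists>t h. directed_orientation CARD('n) H (gain_ends H) t h"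
proof -
  obtain p where "pinned_S_regular S \<theta> \<tau> G rep H p" using pinned_S_regular_exists by blast
  then have inv: "invertible_mat (pinned_orbit_matrix \<tau> rep H p)"
    using iso by (auto simp: pinned_S_isostatic_def)
  have "finite (inner_vs H \<times> (UNIV :: 'n set))" using HH.finite_inner by simp
  then obtain \<phi> where bij: "bij_betw \<phi> (edges H) (inner_vs H \<times> (UNIV :: 'n set))"
    and nz: "\<forall>e\<in>edges H.
      (case \<phi> e of (w, k) \<Rightarrow> orbit_matrix_entry \<tau> H (p \<circ> rep) e w $ k) \<noteq> 0"
    using invertible_indexed_mat_matching[OF inv[unfolded pinned_orbit_matrix_def] HH.finite_edges]
    by blast
  define t where "t e = fst (\<phi> e)" for e
  define h where "h e = (if t e = src H e then tgt H e else src H e)" for e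
  \<comment> \<open>A row of the orbit matrix vanishes away from the ends of its edge.\<close>
  have "t e = src H e \<or> t e = tgt H e" if "e \<in> edges H" for e
    using bspec[OF nz that] by (auto simp: t_def orbit_matrix_entry_def Let_def split: prod.splits if_splits)
  then have ends: "gain_ends H e = {t e, h e}" if "e \<in> edges H" for e
    using that by (auto simp: gain_ends_def h_def)
  have inner: "out_degree H t w = CARD('n)" if "w \<in> inner_vs H" for w
  proof -
    have "bij_betw \<phi> {e \<in> edges H. t e = w} ({w} \<times> (UNIV :: 'n set))"
      unfolding bij_betw_def
    proof (intro conjI equalityI subsetI)
      show "inj_on \<phi> {e \<in> edges H. t e = w}"
        using bij by (auto simp: bij_betw_def intro: inj_on_subset)
    next
      fix c assume "c \<in> {w} \<times> (UNIV :: 'n set)"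
      then have c: "c \<in> inner_vs H \<times> UNIV" "fst c = w" using that by auto
      then obtain e where e: "e \<in> edges H" "c = \<phi> e"
        using bij_betw_imp_surj_on[OF bij] by blast
      then have "t e = w" using c by (simp add: t_def)
      then show "c \<in> \<phi> ` {e \<in> edges H. t e = w}" using e by blast
    qed (auto simp: t_def mem_Times_iff)
    then have "card {e \<in> edges H. t e = w} = card ({w} \<times> (UNIV :: 'n set))"
      by (rule bij_betw_same_card)
    then show ?thesis by (simp add: out_degree_def card_cartesian_product)
  qed
  have "{e \<in> edges H. t e = w} = {}" if "w \<in> pinned_vs H" for w
  proof -
    \<comment> \<open>Only inner vertices have columns.\<close>
    have "t e \<in> inner_vs H" if "e \<in> edges H" for e
      using bij_betwE[OF bij] that by (auto simp: t_def mem_Times_iff)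
    then show ?thesis using that disjoint_H by blast
  qed
  then have "out_degree H t w = 0" if "w \<in> pinned_vs H" for w
    using that unfolding out_degree_def by (metis card.empty)
  then show ?thesis using ends inner unfolding directed_orientation_def by blast
qed

theorem theorem7:
  fixes S :: "('s, 'b) monoid_scheme"
    and \<theta> :: "'s \<Rightarrow> 'v \<Rightarrow> 'v"
    and \<tau> :: "'s \<Rightarrow> real ^ 'n ^ 'n"
    and G :: "('v, 'v set) pinned_graph"
    and rep :: "'v set \<Rightarrow> 'v"
    and H :: "('v set, 'v set set, 's) gain_graph"
  assumes "group S" and "finite (carrier S)"
    and "simple_pinned_graph G"
    and "acts_on_pinned_graph S \<theta> G"
    and "orthogonal_rep S \<tau>"
    and "quotient_gain_graph S \<theta> G rep H"
    and "pinned_S_isostatic S \<theta> \<tau> G rep H"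
    and "\<And>p. pinned_S_regular S \<theta> \<tau> G rep H p \<Longrightarrow> pinned_isostatic G p"
    and "free_on_vertices S \<theta> G"
    and "free_on_edges S \<theta> G"
  shows "(\<forall>C \<in> d_assur_components CARD('n) G. project S \<theta> C \<in> S_assur_components CARD('n) H) \<and>
         (\<forall>D \<in> S_assur_components CARD('n) H.
            \<exists>\<K> \<subseteq> d_assur_components CARD('n) G.
              \<K> \<noteq> {} \<and> pairwise (\<lambda>A B. inner_vs A \<inter> inner_vs B = {}) \<K> \<and>
              lift S \<theta> G D = union_graph \<K>)"
proof -
  interpret pinned_cover S \<theta> G rep H
    using assms by (intro pinned_cover.intro pinned_cover_axioms.intro)
  let ?d = "CARD('n)"
  show ?thesis
  proof (intro conjI ballI)
    fix C assume "C \<in> d_assur_components ?d G"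
    then obtain t' h' u where or': "directed_orientation ?d G (\<lambda>e. e) t' h'" and u: "u \<in> inner_vs G"
      and C: "C = out_piece G t' h' (mutual (arc_rel (edges G) t' h') u)"
      unfolding d_assur_components_def by (rule GG.assur_componentE)
    obtain t0 h0 where or: "directed_orientation ?d H (gain_ends H) t0 h0"
      using isostatic_orientation assms(7) by blast
    obtain t h where lift: "equivariant_lift ?d t0 h0 t h"
      using equivariant_lift_exists[OF or] by blast
    interpret L: lifted_orientation S \<theta> G rep H ?d t0 h0 t h
      by unfold_locales (rule or lift)+
    interpret two_orientations G "\<lambda>e. e" ?d t' h' t h
      by unfold_locales (rule or')
    \<comment> \<open>The orientation exhibiting \<open>C\<close> may fail to be equivariant, so it
      is exchanged for the lifted one.\<close>
    have "C = out_piece G t h (mutual L.OG.R u)" using out_piece_transfer[OF u] C by simp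
    then show "project S \<theta> C \<in> S_assur_components ?d H"
      using L.project_out_piece[OF u] L.OH.mutual_component u
      by (simp add: S_assur_components_def inner_H)
  next
    fix D assume "D \<in> S_assur_components ?d H"
    then obtain t0 h0 w where or: "directed_orientation ?d H (gain_ends H) t0 h0"
      and w: "w \<in> inner_vs H" and D: "D = out_piece H t0 h0 (mutual (arc_rel (edges H) t0 h0) w)"
      unfolding S_assur_components_def by (rule HH.assur_componentE)
    \<comment> \<open>Here the orientation exhibiting \<open>D\<close> is itself lifted.\<close>
    obtain t h where lift: "equivariant_lift ?d t0 h0 t h"
      using equivariant_lift_exists[OF or] by blast
    interpret L: lifted_orientation S \<theta> G rep H ?d t0 h0 t h
      by unfold_locales (rule or lift)+
    let ?K = "{out_piece G t h (mutual L.OG.R u) | u. u \<in> inner_vs G \<and> cov u \<in> mutual L.OH.R w}"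
    have "?K \<subseteq> d_assur_components ?d G"
      using L.OG.mutual_component by (auto simp: d_assur_components_def)
    then show "\<exists>\<K> \<subseteq> d_assur_components ?d G. \<K> \<noteq> {} \<and>
        pairwise (\<lambda>A B. inner_vs A \<inter> inner_vs B = {}) \<K> \<and> lift S \<theta> G D = union_graph \<K>"
      using L.lift_out_piece[OF w] unfolding D by blast
  qed
qed

end
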